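(* Let $N\ge 1$ be an integer and $\alpha>0$. For $v=(v_1,\dots,v_N)$ with $v_j=v_j(t,x)$, $x\in[0,\infty)$, define $u=T^{-1}v=(u_1,\dots,u_N)$ by $$u_j(t,x)=\frac1{\alpha}\left[\frac1N\sum_{k=1}^N v_k(t,x)-v_j(t,x)\right]-\frac1{N^2}\int_x^\infty e^{-\alpha(s-x)/N}\sum_{k=1}^N v_k(t,s)\,ds .$$ If $v(t,x)$ solves a Dirichlet problem for a constant-coefficient partial differential equation on the infinite star graph with $N$ edges (that is, each $v_j$ satisfies the equation and $v_j(t,0)=0$ for $j=1,\dots,N$), then $u(t,x)$ solves the corresponding Exner--Šeba problem, though with different initial data: each $u_j$ satisfies the same partial differential equation, and $$u_1(t,0)=u_2(t,0)=\dots=u_N(t,0)=:u(t,0),\qquad \sum_{j=1}^N \frac{\partial u_j}{\partial x}(t,0)=\alpha\,u(t,0).$$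
   Context: The infinite star graph consists of one vertex with $N$ infinite edges attached; $x\in[0,\infty)$ is the distance from the vertex along edge $j$, and functions on the graph are $N$-tuples $(u_1(x),\dots,u_N(x))$, the Hilbert space being $L^2(0,\infty)^N$. The self-adjoint operator is $H=-d^2/dx^2$ on every edge, with vertex conditions. All vertex conditions include continuity, $u_j(0)=u(0)$ for all $j$; the Dirichlet condition adds $u(0)=0$, and the Exner--Šeba (or $\delta$, or generalized Robin) condition adds $\sum_j u_j'(0)=\alpha u(0)$. Typical equations are the wave equation $u_{tt}=u_{xx}$, the heat equation $u_t=u_{xx}$, the Schrödinger equation $iu_t=-u_{xx}$ and the elliptic "cylinder" equation $u_{tt}=Hu=-u_{xx}$. The formula for $u=T^{-1}v$ is obtained by solving the ordinary differential equation $v=Tu$, where $(Tu)_j(x)=\sum_{k=1}^N u_k'(x)-\alpha u_j(x)$, with the condition of decay as $x\to\infty$.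
   Formalization: Solutions are classical, and it is assumed that the integrals of e^{-αs/N} times v_k and its time derivatives up to the orders occurring converge absolutely and locally uniformly in t; without decay the integral defining u can diverge (heat equation, v_j = e^{k²t} sinh kx, k > α/N). *)

theory Defs
  imports "HOL-Analysis.Analysis"
begin

text \<open>
  An edge is the half-line \<open>{0..}\<close>, and a function on the star graph with \<open>N\<close> edges is a family
  \<open>v j t x\<close> with \<open>j \<in> {1..N}\<close>, \<open>t\<close> in a time interval \<open>I\<close> and \<open>x \<ge> 0\<close>. Values for other
  arguments are irrelevant. Functions are complex-valued because of the Schroedinger equation.
\<close>

text \<open>
  Partial derivatives are one-sided at the vertex \<open>x = 0\<close> and at those end points of \<open>I\<close> that
  belong to \<open>I\<close>.
\<close>

definition deriv_t :: "real set \<Rightarrow> (real \<Rightarrow> real \<Rightarrow> complex) \<Rightarrow> real \<Rightarrow> real \<Rightarrow> complex" where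
  "deriv_t I f = (\<lambda>t x. vector_derivative (\<lambda>\<tau>. f \<tau> x) (at t within I))"

definition deriv_x :: "(real \<Rightarrow> real \<Rightarrow> complex) \<Rightarrow> real \<Rightarrow> real \<Rightarrow> complex" where
  "deriv_x f = (\<lambda>t x. vector_derivative (\<lambda>\<xi>. f t \<xi>) (at x within {0..}))"

definition partial_deriv ::
    "real set \<Rightarrow> nat \<Rightarrow> nat \<Rightarrow> (real \<Rightarrow> real \<Rightarrow> complex) \<Rightarrow> real \<Rightarrow> real \<Rightarrow> complex" where
  "partial_deriv I m n f = (deriv_t I ^^ m) ((deriv_x ^^ n) f)"

text \<open>
  The coefficient family \<open>a\<close>, of finite support, stands for the equation
  \<open>\<Sum>m n. a m n * \<partial>\<^sub>t\<^sup>m \<partial>\<^sub>x\<^sup>n f = 0\<close>. For instance, the heat equation has \<open>a 1 0 = 1\<close>,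
  \<open>a 0 2 = -1\<close> and no other nonzero coefficient.

  A classical solution has continuous derivatives of those orders that occur in the equation or
  are below an order that occurs (so \<open>C\<^sup>1\<close> in time and \<open>C\<^sup>2\<close> in space for the heat equation). The
  order \<open>(0, 1)\<close> is always included, since vertex conditions involve first derivatives in space.
\<close>

definition support_orders :: "(nat \<Rightarrow> nat \<Rightarrow> complex) \<Rightarrow> (nat \<times> nat) set" where
  "support_orders a = {(m, n). a m n \<noteq> 0}"

definition required_orders :: "(nat \<Rightarrow> nat \<Rightarrow> complex) \<Rightarrow> (nat \<times> nat) set" where
  "required_orders a =
     {(0, 0), (0, 1)} \<union> {(m, n). \<exists>(m', n') \<in> support_orders a. m \<le> m' \<and> n \<le> n'}"

text \<open>
  Requiring the \<open>x\<close>-derivative of \<open>partial_deriv I m n f\<close> to be \<open>partial_deriv I m (Suc n) f\<close>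
  also for \<open>m > 0\<close> says that mixed derivatives do not depend on the order of differentiation.
\<close>

definition has_continuous_derivs ::
    "real set \<Rightarrow> (nat \<times> nat) set \<Rightarrow> (real \<Rightarrow> real \<Rightarrow> complex) \<Rightarrow> bool" where
  "has_continuous_derivs I S f \<longleftrightarrow>
     (\<forall>(m, n) \<in> S.
        continuous_on (I \<times> {0..}) (\<lambda>(t, x). partial_deriv I m n f t x) \<and>
        ((Suc m, n) \<in> S \<longrightarrow> (\<forall>t\<in>I. \<forall>x\<ge>0.
           ((\<lambda>\<tau>. partial_deriv I m n f \<tau> x) has_vector_derivative
              partial_deriv I (Suc m) n f t x) (at t within I))) \<and>
        ((m, Suc n) \<in> S \<longrightarrow> (\<forall>t\<in>I. \<forall>x\<ge>0.
           ((\<lambda>\<xi>. partial_deriv I m n f t \<xi>) has_vector_derivative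
              partial_deriv I m (Suc n) f t x) (at x within {0..}))))"

definition solves_pde ::
    "(nat \<Rightarrow> nat \<Rightarrow> complex) \<Rightarrow> real set \<Rightarrow> (real \<Rightarrow> real \<Rightarrow> complex) \<Rightarrow> bool" where
  "solves_pde a I f \<longleftrightarrow>
     has_continuous_derivs I (required_orders a) f \<and>
     (\<forall>t\<in>I. \<forall>x\<ge>0. (\<Sum>(m, n)\<in>support_orders a. a m n * partial_deriv I m n f t x) = 0)"

definition dirichlet_solution ::
    "nat \<Rightarrow> (nat \<Rightarrow> nat \<Rightarrow> complex) \<Rightarrow> real set \<Rightarrow> (nat \<Rightarrow> real \<Rightarrow> real \<Rightarrow> complex) \<Rightarrow> bool" where
  "dirichlet_solution N a I v \<longleftrightarrow>
     (\<forall>j\<in>{1..N}. solves_pde a I (v j)) \<and>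
     (\<forall>j\<in>{1..N}. \<forall>t\<in>I. v j t 0 = 0)"

text \<open>In the vertex condition, \<open>c\<close> is the common value \<open>u(t, 0)\<close>.\<close>

definition exner_seba_solution ::
    "real \<Rightarrow> nat \<Rightarrow> (nat \<Rightarrow> nat \<Rightarrow> complex) \<Rightarrow> real set \<Rightarrow> (nat \<Rightarrow> real \<Rightarrow> real \<Rightarrow> complex) \<Rightarrow> bool" where
  "exner_seba_solution \<alpha> N a I u \<longleftrightarrow>
     (\<forall>j\<in>{1..N}. solves_pde a I (u j)) \<and>
     (\<forall>t\<in>I. \<exists>c. (\<forall>j\<in>{1..N}. u j t 0 = c) \<and>
              (\<Sum>j=1..N. deriv_x (u j) t 0) = of_real \<alpha> * c)"

definition T_inverse ::
    "real \<Rightarrow> nat \<Rightarrow> (nat \<Rightarrow> real \<Rightarrow> real \<Rightarrow> complex) \<Rightarrow> nat \<Rightarrow> real \<Rightarrow> real \<Rightarrow> complex" where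
  "T_inverse \<alpha> N v j t x =
     1 / of_real \<alpha> * (1 / of_nat N * (\<Sum>k=1..N. v k t x) - v j t x)
     - 1 / (of_nat N)\<^sup>2 *
       (LINT s:{x..}|lborel. of_real (exp (- \<alpha> * (s - x) / real N)) * (\<Sum>k=1..N. v k t s))"

text \<open>
  Decay at infinity, in the form needed for \<open>T_inverse\<close> to make sense and to be differentiable
  in time: the integral of every time derivative that occurs converges absolutely and locally
  uniformly in \<open>t\<close>. By the Cauchy-Schwarz inequality this holds whenever the norms of these
  derivatives in \<open>L\<^sup>2(0, \<infinity>)\<close> are locally bounded in \<open>t\<close>; it also allows bounded solutions, and
  solutions that grow exponentially at a rate below \<open>\<alpha> / N\<close>.
\<close>

definition T_inverse_converges ::
    "real \<Rightarrow> nat \<Rightarrow> (nat \<Rightarrow> nat \<Rightarrow> complex) \<Rightarrow> real set \<Rightarrow> (nat \<Rightarrow> real \<Rightarrow> real \<Rightarrow> complex) \<Rightarrow> bool" where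
  "T_inverse_converges \<alpha> N a I v \<longleftrightarrow>
     (\<forall>k\<in>{1..N}. \<forall>m. (m, 0) \<in> required_orders a \<longrightarrow>
        (let w = (\<lambda>t s. of_real (exp (- \<alpha> * s / real N)) * partial_deriv I m 0 (v k) t s) in
          (\<forall>t\<in>I. set_integrable lborel {0..} (w t)) \<and>
          (\<forall>K. compact K \<and> K \<subseteq> I \<longrightarrow>
             (\<forall>\<epsilon>>0. \<exists>R\<ge>0. \<forall>t\<in>K. (LINT s:{R..}|lborel. norm (w t s)) < \<epsilon>))))"

end

theory Submission
  imports Defs
begin

text \<open>
  Put \<open>\<beta> = \<alpha> / N\<close> and \<open>J\<^sub>k(t, x) = \<integral> exp (-\<beta> (s - x)) v\<^sub>k(t, s) ds\<close> over \<open>s \<ge> x\<close>. Since \<open>T_inverse\<close> is a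
  linear combination of the \<open>v\<^sub>k\<close> and the \<open>J\<^sub>k\<close>, it suffices that each \<open>J = J\<^sub>k\<close> solves the equation; the
  vertex condition is then read off from \<open>\<partial>\<^sub>x J\<^sub>k = \<beta> J\<^sub>k - v\<^sub>k\<close> and \<open>v\<^sub>k(t, 0) = 0\<close>.

  Let \<open>W\<close> be the differential operator applied to \<open>J\<close>. It commutes with \<open>\<partial>\<^sub>x - \<beta>\<close>, and
  \<open>(\<partial>\<^sub>x - \<beta>) J = - v\<^sub>k\<close> solves the equation, so \<open>\<partial>\<^sub>x W = \<beta> W\<close> and \<open>W = C(t) exp (\<beta> x)\<close>. There is no bound on the \<open>x\<close>-derivatives of \<open>v\<close>, hence none
  on \<open>W\<close> itself; but \<open>W\<close> is a sum of \<open>x\<close>-derivatives of the functions \<open>\<partial>\<^sub>t\<^sup>m J = o(exp (\<beta> x))\<close>, so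
  repeated averaging over unit intervals turns each term into an \<open>o(exp (\<beta> x))\<close>, whereas averaging only
  multiplies \<open>exp (\<beta> x)\<close> by a nonzero constant. Therefore \<open>C(t) = 0\<close>.
\<close>

subsection \<open>Integrals over the half-line that depend on a parameter\<close>

text \<open>Splitting the half-line at \<open>x\<close> leaves \<open>x\<close> only as an end point
  of a compact interval, where continuity and differentiation theorems apply.\<close>

lemma tail_integral_eq:
  fixes w :: "real \<Rightarrow> complex"
  assumes "set_integrable lborel {0..} w" "0 \<le> x"
  shows "(LINT s:{x..}|lborel. w s) = integral {0..} w - integral {0..x} w"
proof -
  have int: "set_integrable lborel {x..} w" "set_integrable lborel {0..x} w"
    using assms by (auto intro!: set_integrable_subset[OF assms(1)])
  have "{0..x} \<inter> {x..} = {x}" "{0..x} \<union> {x..} = {0..}"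
    using assms(2) by auto
  then have "integral {0..} w = integral {0..x} w + integral {x..} w"
    using integral_Un[of w "{0..x}" "{x..}"] set_borel_integral_eq_integral(1)[OF int(1)]
      set_borel_integral_eq_integral(1)[OF int(2)]
    by (metis negligible_sing)
  then show ?thesis
    by (simp add: set_borel_integral_eq_integral(2)[OF int(1)])
qed

text \<open>The error of truncating at \<open>x\<close> is the tail integral. It is bounded by the
  tail of the norm, which decreases as \<open>x\<close> grows, so one \<open>R\<close> serves all
  later truncations.\<close>

lemma uniform_limit_integral_tail:
  fixes w :: "'a \<Rightarrow> real \<Rightarrow> complex"
  assumes int: "\<And>t. t \<in> K \<Longrightarrow> set_integrable lborel {0..} (w t)"
    and tail: "\<And>\<epsilon>. \<epsilon> > 0 \<Longrightarrow> \<exists>R\<ge>0. \<forall>t\<in>K. (LINT s:{R..}|lborel. norm (w t s)) < \<epsilon>"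
  shows "uniform_limit K (\<lambda>R t. integral {0..R} (w t)) (\<lambda>t. integral {0..} (w t)) at_top"
proof (rule uniform_limitI)
  fix \<epsilon> :: real assume "\<epsilon> > 0"
  then obtain R where R: "R \<ge> 0" "\<And>t. t \<in> K \<Longrightarrow> (LINT s:{R..}|lborel. norm (w t s)) < \<epsilon>"
    using tail by blast
  have "dist (integral {0..x} (w t)) (integral {0..} (w t)) < \<epsilon>" if "x \<ge> R" "t \<in> K" for x t
  proof -
    have x: "set_integrable lborel {x..} (w t)" "set_integrable lborel {R..} (w t)"
      using that R(1) by (auto intro!: set_integrable_subset[OF int[OF that(2)]])
    have "dist (integral {0..x} (w t)) (integral {0..} (w t)) = norm (LINT s:{x..}|lborel. w t s)"
      using tail_integral_eq[OF int[OF that(2)], of x] that R(1)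
      by (simp add: dist_norm norm_minus_commute)
    also have "\<dots> \<le> (LINT s:{x..}|lborel. norm (w t s))"
      by (rule set_integral_norm_bound[OF x(1)])
    also have "\<dots> \<le> (LINT s:{R..}|lborel. norm (w t s))"
      using that(1) set_integrable_norm[OF x(1)] set_integrable_norm[OF x(2)]
      unfolding set_lebesgue_integral_def set_integrable_def
      by (intro integral_mono) (auto simp: indicator_def)
    also have "\<dots> < \<epsilon>"
      using R(2) that(2) by blast
    finally show ?thesis .
  qed
  then show "\<forall>\<^sub>F x in at_top. \<forall>t\<in>K. dist (integral {0..x} (w t)) (integral {0..} (w t)) < \<epsilon>"
    by (auto simp: eventually_at_top_linorder)
qed

text \<open>Tail bounds are uniform only on compact subsets of \<open>I\<close>, while derivatives
  are taken within \<open>I\<close>. A compact subinterval with the same filter at \<open>t\<close>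
  connects the two; an end point of it may equal \<open>t\<close> only where \<open>I\<close> itself
  ends.\<close>

lemma is_interval_compact_neighbourhood:
  fixes I :: "real set"
  assumes "is_interval I" "t \<in> I"
  obtains c d where "{c..d} \<subseteq> I" "t \<in> {c..d}" "at t within {c..d} = at t within I"
proof -
  obtain c where c: "c \<in> I" "c \<le> t" "c = t \<Longrightarrow> \<forall>s\<in>I. t \<le> s"
    using assms(2) by (metis linorder_le_less_linear order_less_imp_le order_less_irrefl order_refl)
  obtain d where d: "d \<in> I" "t \<le> d" "d = t \<Longrightarrow> \<forall>s\<in>I. s \<le> t"
    using assms(2) by (metis linorder_le_less_linear order_less_imp_le order_less_irrefl order_refl)
  \<comment> \<open>On a side where \<open>I\<close> ends at \<open>t\<close>, the open set
    \<open>S\<close> reaches beyond \<open>t\<close> by 1, which adds no points of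
    \<open>I\<close>.\<close>
  define S where "S = {(if c = t then t - 1 else c) <..< (if d = t then t + 1 else d)}"
  have "{c..d} \<subseteq> I"
    using mem_is_interval_1_I[OF assms(1) c(1) d(1)] by auto
  moreover have S: "t \<in> S" "open S"
    using c(2) d(2) by (auto simp: S_def)
  moreover have "I \<inter> S \<subseteq> {c..d}"
    using c(3) d(3) by (force simp: S_def split: if_splits)
  ultimately have "{c..d} \<inter> S - {t} = I \<inter> S - {t}"
    by blast
  then have "at t within {c..d} = at t within I"
    by (rule at_within_nhd[OF S])
  then show ?thesis
    using c(2) d(2) \<open>{c..d} \<subseteq> I\<close> by (intro that[of c d]) auto
qed

text \<open>A connected set with more than one point has no isolated points; this is what makes
  one-sided derivatives unique.\<close>

lemma at_within_interval_neq_bot: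
  fixes I :: "real set"
  assumes "is_interval I" "interior I \<noteq> {}" "t \<in> I"
  shows "at t within I \<noteq> bot"
proof -
  have "connected I" "\<not> (\<exists>a. I = {a})"
    using assms(1,2) by (auto simp: is_interval_connected_1)
  then show ?thesis
    using connected_imp_perfect[of I t] assms(3) by (simp add: trivial_limit_within)
qed

lemma continuous_on_section:
  assumes "continuous_on (I \<times> A) (\<lambda>(t, x). f t x)" "t \<in> I"
  shows "continuous_on A (f t)"
proof -
  have "continuous_on A (\<lambda>x. (t, x))"
    by (intro continuous_intros)
  moreover have "(\<lambda>x. (t, x)) ` A \<subseteq> I \<times> A"
    using assms(2) by auto
  ultimately show ?thesis
    using continuous_on_compose2[OF assms(1)] by fastforce
qed

text \<open>The substitution \<open>s = x * r\<close> moves the variable end point into the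
  integrand, leaving a parameter integral over the fixed interval [0, 1]. It degenerates at
  \<open>x = 0\<close>, where both sides vanish.\<close>

lemma continuous_on_integral_from_zero:
  fixes w :: "real \<Rightarrow> real \<Rightarrow> complex"
  assumes "continuous_on (I \<times> {0..}) (\<lambda>(t, s). w t s)"
  shows "continuous_on (I \<times> {0..}) (\<lambda>(t, x). integral {0..x} (w t))"
proof -
  have "continuous_on ((I \<times> {0..}) \<times> cbox 0 (1 :: real)) (\<lambda>(p, r). w (fst p) (snd p * r))"
    unfolding case_prod_unfold
    by (rule continuous_on_compose2[OF assms[unfolded case_prod_unfold],
          where f = "\<lambda>q. (fst (fst q), snd (fst q) * snd q)", simplified])
      (auto intro!: continuous_on_Pair continuous_on_mult continuous_on_fst continuous_on_snd continuous_on_id)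
  then have "continuous_on (I \<times> {0..}) (\<lambda>p. integral (cbox 0 1) (\<lambda>r. w (fst p) (snd p * r)))"
    by (rule integral_continuous_on_param)
  then have "continuous_on (I \<times> {0..}) (\<lambda>p. snd p *\<^sub>R integral {0..1} (\<lambda>r. w (fst p) (snd p * r)))"
    unfolding box_real(2) by (intro continuous_intros)
  moreover have "x *\<^sub>R integral {0..1} (\<lambda>r. w t (x * r)) = integral {0..x} (w t)" if "0 \<le> x" for t x
  proof (cases "x = 0")
    case False
    then have "(\<lambda>r. r / x) ` {0..x} = {0..1}"
      using that by auto
    then show ?thesis
      using integral_stretch_real[of x 0 x "w t"] False that by simp
  qed simp
  ultimately show ?thesis
    by (elim continuous_on_eq) auto
qed

text \<open>Near each point of \<open>I\<close> the integral is a uniform limit of truncated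
  integrals, which are continuous.\<close>

lemma continuous_on_integral_half_line:
  fixes w :: "real \<Rightarrow> real \<Rightarrow> complex"
  assumes I: "is_interval I"
    and cont: "continuous_on (I \<times> {0..}) (\<lambda>(t, s). w t s)"
    and int: "\<And>t. t \<in> I \<Longrightarrow> set_integrable lborel {0..} (w t)"
    and tail: "\<And>K \<epsilon>. \<lbrakk>compact K; K \<subseteq> I; \<epsilon> > 0\<rbrakk> \<Longrightarrow>
      \<exists>R\<ge>0. \<forall>t\<in>K. (LINT s:{R..}|lborel. norm (w t s)) < \<epsilon>"
  shows "continuous_on I (\<lambda>t. integral {0..} (w t))"
  unfolding continuous_on_eq_continuous_within
proof
  fix t assume "t \<in> I"
  then obtain c d where K: "{c..d} \<subseteq> I" "t \<in> {c..d}" "at t within {c..d} = at t within I"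
    using is_interval_compact_neighbourhood I by blast
  have "continuous_on {c..d} (\<lambda>t. integral {0..R} (w t))" if "R \<ge> 0" for R
    by (rule continuous_on_compose2[OF continuous_on_integral_from_zero[OF cont],
          where f = "\<lambda>t. (t, R)", simplified])
      (use K(1) that in \<open>auto intro: continuous_on_Pair continuous_on_id continuous_on_const\<close>)
  then have "\<forall>\<^sub>F R in at_top. continuous_on {c..d} (\<lambda>t. integral {0..R} (w t))"
    by (auto simp: eventually_at_top_linorder)
  then have "continuous_on {c..d} (\<lambda>t. integral {0..} (w t))"
    by (rule uniform_limit_theorem)
      (use K(1) int tail[of "{c..d}"] in \<open>auto intro!: uniform_limit_integral_tail\<close>)
  then show "continuous (at t within I) (\<lambda>t. integral {0..} (w t))"
    unfolding continuous_on_eq_continuous_within using K(2,3) by metis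
qed

lemma has_vector_derivative_integral_from_zero:
  fixes w w' :: "real \<Rightarrow> real \<Rightarrow> complex"
  assumes I: "is_interval I" "t \<in> I"
    and cont: "continuous_on (I \<times> {0..}) (\<lambda>(t, s). w t s)"
    and cont': "continuous_on (I \<times> {0..}) (\<lambda>(t, s). w' t s)"
    and deriv: "\<And>t s. \<lbrakk>t \<in> I; s \<ge> 0\<rbrakk> \<Longrightarrow>
      ((\<lambda>\<tau>. w \<tau> s) has_vector_derivative w' t s) (at t within I)"
  shows "((\<lambda>\<tau>. integral {0..x} (w \<tau>)) has_vector_derivative integral {0..x} (w' t)) (at t within I)"
proof -
  have "w t integrable_on cbox 0 x" if "t \<in> I" for t
    by (rule integrable_continuous)
      (rule continuous_on_subset[OF continuous_on_section[OF cont that]], auto)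
  moreover have "continuous_on (I \<times> cbox 0 x) (\<lambda>(t, s). w' t s)"
    by (rule continuous_on_subset[OF cont']) auto
  ultimately show ?thesis
    using leibniz_rule_vector_derivative[of I 0 x w w' t] I deriv
    by (auto simp: is_interval_convex)
qed

text \<open>The truncated integrals are differentiated by the Leibniz rule, and their derivatives
  converge uniformly on a compact neighbourhood because of the tails of \<open>w'\<close>. Hence
  limit and derivative commute there.\<close>

lemma has_vector_derivative_integral_half_line:
  fixes w w' :: "real \<Rightarrow> real \<Rightarrow> complex"
  assumes I: "is_interval I" "t \<in> I"
    and cont: "continuous_on (I \<times> {0..}) (\<lambda>(t, s). w t s)"
    and cont': "continuous_on (I \<times> {0..}) (\<lambda>(t, s). w' t s)"
    and deriv: "\<And>t s. \<lbrakk>t \<in> I; s \<ge> 0\<rbrakk> \<Longrightarrow>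
      ((\<lambda>\<tau>. w \<tau> s) has_vector_derivative w' t s) (at t within I)"
    and int: "\<And>t. t \<in> I \<Longrightarrow> set_integrable lborel {0..} (w t)"
    and int': "\<And>t. t \<in> I \<Longrightarrow> set_integrable lborel {0..} (w' t)"
    and tail: "\<And>K \<epsilon>. \<lbrakk>compact K; K \<subseteq> I; \<epsilon> > 0\<rbrakk> \<Longrightarrow>
      \<exists>R\<ge>0. \<forall>t\<in>K. (LINT s:{R..}|lborel. norm (w t s)) < \<epsilon>"
    and tail': "\<And>K \<epsilon>. \<lbrakk>compact K; K \<subseteq> I; \<epsilon> > 0\<rbrakk> \<Longrightarrow>
      \<exists>R\<ge>0. \<forall>t\<in>K. (LINT s:{R..}|lborel. norm (w' t s)) < \<epsilon>"
  shows "((\<lambda>\<tau>. integral {0..} (w \<tau>)) has_vector_derivative integral {0..} (w' t)) (at t within I)"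
proof -
  obtain c d where K: "{c..d} \<subseteq> I" "t \<in> {c..d}" "at t within {c..d} = at t within I"
    using is_interval_compact_neighbourhood I by blast
  define K where "K = {c..d}"
  have seq: "filterlim real at_top sequentially"
    by (rule filterlim_real_sequentially)
  have lim': "uniform_limit K (\<lambda>n t. integral {0..real n} (w' t)) (\<lambda>t. integral {0..} (w' t)) sequentially"
    using K(1) int' tail'[of K]
    by (intro filterlim_compose[OF _ seq] uniform_limit_integral_tail) (auto simp: K_def)
  have lim: "uniform_limit K (\<lambda>n t. integral {0..real n} (w t)) (\<lambda>t. integral {0..} (w t)) sequentially"
    using K(1) int tail[of K]
    by (intro filterlim_compose[OF _ seq] uniform_limit_integral_tail) (auto simp: K_def)
  have pointwise: "(\<lambda>n. integral {0..real n} (w s)) \<longlonglongrightarrow> integral {0..} (w s)" if "s \<in> K" for s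
    using tendsto_uniform_limitI[OF lim that] .
  have "\<exists>g. \<forall>s\<in>K. (\<lambda>n. integral {0..real n} (w s)) \<longlonglongrightarrow> g s \<and>
      (g has_derivative (\<lambda>h. h *\<^sub>R integral {0..} (w' s))) (at s within K)"
  proof (rule has_derivative_sequence)
    show "((\<lambda>\<tau>. integral {0..real n} (w \<tau>)) has_derivative (\<lambda>h. h *\<^sub>R integral {0..real n} (w' s)))
        (at s within K)" if "s \<in> K" for n s
      using has_vector_derivative_within_subset[OF
          has_vector_derivative_integral_from_zero[OF I(1) _ cont cont' deriv] K(1)] that K(1)
      by (auto simp: has_vector_derivative_def K_def)
    show "\<forall>\<^sub>F n in sequentially. \<forall>s\<in>K. \<forall>h. norm (h *\<^sub>R integral {0..real n} (w' s)
        - h *\<^sub>R integral {0..} (w' s)) \<le> \<epsilon> * norm h" if "\<epsilon> > 0" for \<epsilon>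
      using uniform_limitD[OF lim' that]
    proof eventually_elim
      case (elim n)
      have "norm (h *\<^sub>R integral {0..real n} (w' s) - h *\<^sub>R integral {0..} (w' s)) \<le> \<epsilon> * norm h"
        if "s \<in> K" for s h
        using mult_left_mono[OF less_imp_le[OF elim[rule_format, OF that]], of "\<bar>h\<bar>"]
        by (simp add: dist_norm mult.commute flip: scaleR_diff_right)
      then show ?case by blast
    qed
  qed (use K(2) pointwise in \<open>auto simp: K_def\<close>)
  then obtain g where g: "\<And>s. s \<in> K \<Longrightarrow> (\<lambda>n. integral {0..real n} (w s)) \<longlonglongrightarrow> g s"
    "\<And>s. s \<in> K \<Longrightarrow> (g has_vector_derivative integral {0..} (w' s)) (at s within K)"
    by (auto simp: has_vector_derivative_def)
  have "g s = integral {0..} (w s)" if "s \<in> K" for s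
    using LIMSEQ_unique g(1) pointwise that by blast
  then show ?thesis
    using has_vector_derivative_transform[OF _ _ g(2)[of t]] K(2,3) by (auto simp: K_def)
qed

subsection \<open>Derivatives of functions of subexponential growth\<close>

text \<open>
  A property of \<open>n\<close>-th derivatives \<open>h\<close> of functions that are \<open>o(exp (\<beta> x))\<close>: averaging \<open>n\<close> times
  over unit intervals (\<open>H (x + 1) - H x\<close> is the integral of \<open>h\<close> over \<open>[x, x + 1]\<close>) produces such a
  function.
\<close>

primrec subexp_deriv :: "real \<Rightarrow> nat \<Rightarrow> (real \<Rightarrow> complex) \<Rightarrow> bool" where
  "subexp_deriv \<beta> 0 h \<longleftrightarrow>
     continuous_on {0..} h \<and> ((\<lambda>x. exp (- \<beta> * x) *\<^sub>R h x) \<longlongrightarrow> 0) at_top"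
| "subexp_deriv \<beta> (Suc n) h \<longleftrightarrow>
     (\<exists>H. (\<forall>x\<ge>0. (H has_vector_derivative h x) (at x within {0..})) \<and>
          subexp_deriv \<beta> n (\<lambda>x. H (x + 1) - H x))"

lemma has_vector_derivative_shift_half_line:
  fixes H :: "real \<Rightarrow> complex"
  assumes "\<And>x. x \<ge> 0 \<Longrightarrow> (H has_vector_derivative h x) (at x within {0..})" "x \<ge> 0"
  shows "((\<lambda>x. H (x + 1)) has_vector_derivative h (x + 1)) (at x within {0..})"
proof -
  have "((\<lambda>x. x + 1) has_vector_derivative 1) (at x within {0..})"
    by (auto intro!: derivative_eq_intros)
  moreover have "(H has_vector_derivative h (x + 1)) (at (x + 1) within (\<lambda>x. x + 1) ` {0..})"
    by (rule has_vector_derivative_within_subset[OF assms(1)]) (use assms(2) in auto)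
  ultimately show ?thesis
    using vector_diff_chain_within[of "\<lambda>x. x + 1" 1 x "{0..}" H "h (x + 1)"]
    by (simp add: o_def)
qed

text \<open>Needed because averages appear as differences of a function and its unit shift. A shift
  costs only the constant factor \<open>exp \<beta>\<close>.\<close>

lemma subexp_deriv_shift:
  "subexp_deriv \<beta> n h \<Longrightarrow> subexp_deriv \<beta> n (\<lambda>x. h (x + 1))"
proof (induction n arbitrary: h)
  case 0
  have "continuous_on {0..} (\<lambda>x. h (x + 1))"
    by (rule continuous_on_compose2[of "{0..}" h]) (use 0 in \<open>auto intro!: continuous_intros\<close>)
  moreover have "filterlim (\<lambda>x :: real. x + 1) at_top at_top"
    by (rule filterlim_at_top_mono[OF filterlim_ident]) simp
  then have "((\<lambda>x. exp (- \<beta> * (x + 1)) *\<^sub>R h (x + 1)) \<longlongrightarrow> 0) at_top"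
    using 0 filterlim_compose[of "\<lambda>x. exp (- \<beta> * x) *\<^sub>R h x" "nhds 0" at_top "\<lambda>x. x + 1" at_top]
    by auto
  then have "((\<lambda>x. exp \<beta> *\<^sub>R (exp (- \<beta> * (x + 1)) *\<^sub>R h (x + 1))) \<longlongrightarrow> exp \<beta> *\<^sub>R 0) at_top"
    by (intro tendsto_intros)
  moreover have "exp \<beta> * exp (- \<beta> * (x + 1)) = exp (- \<beta> * x)" for x
    by (simp add: algebra_simps flip: exp_add)
  ultimately show ?case by simp
next
  case (Suc n)
  then obtain H where "\<forall>x\<ge>0. (H has_vector_derivative h x) (at x within {0..})"
    "subexp_deriv \<beta> n (\<lambda>x. H (x + 1) - H x)"
    by auto
  then show ?case
    using Suc.IH[of "\<lambda>x. H (x + 1) - H x"] has_vector_derivative_shift_half_line[of H h]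
    by (auto intro!: exI[of _ "\<lambda>x. H (x + 1)"])
qed

lemma subexp_deriv_lincomb:
  assumes "subexp_deriv \<beta> n f" "subexp_deriv \<beta> n g"
  shows "subexp_deriv \<beta> n (\<lambda>x. c * f x + d * g x)"
  using assms
proof (induction n arbitrary: f g)
  case 0
  then have "((\<lambda>x. c * (exp (- \<beta> * x) *\<^sub>R f x) + d * (exp (- \<beta> * x) *\<^sub>R g x)) \<longlongrightarrow> c * 0 + d * 0) at_top"
    by (intro tendsto_intros) auto
  moreover have "continuous_on {0..} (\<lambda>x. c * f x + d * g x)"
    using 0 by (intro continuous_intros) auto
  ultimately show ?case by (simp add: algebra_simps)
next
  case (Suc n)
  then obtain F G where
    F: "\<forall>x\<ge>0. (F has_vector_derivative f x) (at x within {0..})" "subexp_deriv \<beta> n (\<lambda>x. F (x + 1) - F x)"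
    and G: "\<forall>x\<ge>0. (G has_vector_derivative g x) (at x within {0..})" "subexp_deriv \<beta> n (\<lambda>x. G (x + 1) - G x)"
    by auto
  have "subexp_deriv \<beta> n (\<lambda>x. c * (F (x + 1) - F x) + d * (G (x + 1) - G x))"
    by (rule Suc.IH) (fact F(2) G(2))+
  then have "subexp_deriv \<beta> n (\<lambda>x. c * F (x + 1) + d * G (x + 1) - (c * F x + d * G x))"
    by (simp add: algebra_simps)
  moreover have "((\<lambda>x. c * F x + d * G x) has_vector_derivative c * f x + d * g x) (at x within {0..})"
    if "x \<ge> 0" for x
    using F(1) G(1) that by (auto intro!: derivative_intros)
  ultimately show ?case
    by auto
qed

lemma has_vector_derivative_indefinite_integral_half_line:
  fixes h :: "real \<Rightarrow> 'a::banach"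
  assumes "continuous_on {0..} h" "x \<ge> 0"
  shows "((\<lambda>x. integral {0..x} h) has_vector_derivative h x) (at x within {0..})"
proof -
  have "((\<lambda>x. integral {0..x} h) has_vector_derivative h x) (at x within {0..x + 1})"
    by (rule integral_has_vector_derivative) (use assms in \<open>auto intro: continuous_on_subset\<close>)
  moreover have "at x within {0..x + 1} = at x within {0..}"
    by (rule at_within_nhd[of _ "{..<x + 1}"]) auto
  ultimately show ?thesis by simp
qed

text \<open>A further averaging does no harm: if \<open>h\<close> is small against
  \<open>exp (\<beta> * s)\<close>, its integral over \<open>{x..x + 1}\<close> is small against
  \<open>exp (\<beta> * (x + 1))\<close>. This allows terms of different orders to be brought to a
  common order.\<close>

lemma subexp_deriv_Suc:
  assumes "\<beta> > 0"
  shows "subexp_deriv \<beta> n h \<Longrightarrow> subexp_deriv \<beta> (Suc n) h"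
proof (induction n arbitrary: h)
  case 0
  define H where "H = (\<lambda>x. integral {0..x} h)"
  have cont: "continuous_on {0..} h"
    using 0 by simp
  have H: "(H has_vector_derivative h x) (at x within {0..})" if "x \<ge> 0" for x
    unfolding H_def by (rule has_vector_derivative_indefinite_integral_half_line[OF cont that])
  have "((\<lambda>x. exp (- \<beta> * x) *\<^sub>R (H (x + 1) - H x)) \<longlongrightarrow> 0) at_top"
    unfolding tendsto_iff
  proof (intro allI impI)
    fix \<epsilon> :: real assume "\<epsilon> > 0"
    \<comment> \<open>The factor \<open>exp \<beta>\<close> absorbs the passage from
      \<open>x + 1\<close> back to \<open>x\<close>; the factor 2 makes the final inequality
      strict.\<close>
    define \<delta> where "\<delta> = \<epsilon> / (2 * exp \<beta>)"
    have "\<delta> > 0"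
      using \<open>\<epsilon> > 0\<close> by (simp add: \<delta>_def)
    then obtain X0 where X0: "\<And>x. x \<ge> X0 \<Longrightarrow> norm (exp (- \<beta> * x) *\<^sub>R h x) < \<delta>"
      using 0 by (force simp: tendsto_iff eventually_at_top_linorder)
    have "dist (exp (- \<beta> * x) *\<^sub>R (H (x + 1) - H x)) 0 < \<epsilon>" if x: "x \<ge> max 0 X0" for x
    proof -
      have int: "h integrable_on {0..x + 1}"
        by (rule integrable_continuous_real) (use cont in \<open>auto intro: continuous_on_subset\<close>)
      then have "H (x + 1) - H x = integral {x..x + 1} h"
        unfolding H_def using x Henstock_Kurzweil_Integration.integral_combine[of 0 x "x + 1" h]
        by (simp add: algebra_simps)
      moreover have "norm (integral {x..x + 1} h) \<le> \<delta> * exp (\<beta> * (x + 1)) * (x + 1 - x)"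
      proof (rule integral_bound)
        show "continuous_on {x..x + 1} h"
          by (rule continuous_on_subset[OF cont]) (use x in auto)
        fix s assume s: "s \<in> {x..x + 1}"
        have "norm (h s) = exp (\<beta> * s) * norm (exp (- \<beta> * s) *\<^sub>R h s)"
          by (simp add: exp_minus)
        also have "\<dots> \<le> exp (\<beta> * (x + 1)) * \<delta>"
          using s x X0[of s] assms by (intro mult_mono) auto
        finally show "norm (h s) \<le> \<delta> * exp (\<beta> * (x + 1))"
          by (simp add: mult.commute)
      qed auto
      ultimately have "norm (exp (- \<beta> * x) *\<^sub>R (H (x + 1) - H x)) \<le> exp (- \<beta> * x) * (\<delta> * exp (\<beta> * (x + 1)))"
        by simp
      also have "\<dots> = \<epsilon> / 2"
        by (simp add: \<delta>_def exp_minus distrib_left exp_add)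
      finally show ?thesis
        using \<open>\<epsilon> > 0\<close> by simp
    qed
    then show "\<forall>\<^sub>F x in at_top. dist (exp (- \<beta> * x) *\<^sub>R (H (x + 1) - H x)) 0 < \<epsilon>"
      unfolding eventually_at_top_linorder by blast
  qed
  moreover have "((\<lambda>x. H (x + 1) - H x) has_vector_derivative h (x + 1) - h x) (at x within {0..})"
    if "x \<ge> 0" for x
    using H has_vector_derivative_shift_half_line[OF H] that by (intro derivative_intros)
  then have "continuous_on {0..} (\<lambda>x. H (x + 1) - H x)"
    by (auto simp: continuous_on_eq_continuous_within intro: has_vector_derivative_continuous)
  ultimately show ?case
    using H by auto
next
  case (Suc n)
  \<comment> \<open>Only the outermost \<open>Suc\<close> is unfolded on each side, so that the same
    primitive \<open>H\<close> serves both and the induction hypothesis applies to its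
    difference.\<close>
  then show ?case
    unfolding subexp_deriv.simps(2)[of _ "Suc n"] subexp_deriv.simps(2)[of _ n h] by blast
qed

lemma subexp_deriv_mono:
  assumes "\<beta> > 0" "n \<le> n'" "subexp_deriv \<beta> n h"
  shows "subexp_deriv \<beta> n' h"
  using assms(2) by (induction n' rule: dec_induct) (simp_all add: assms(3) subexp_deriv_Suc[OF assms(1)] del: subexp_deriv.simps)

lemma subexp_deriv_sum:
  assumes "finite A" "\<And>i. i \<in> A \<Longrightarrow> subexp_deriv \<beta> n (f i)"
  shows "subexp_deriv \<beta> n (\<lambda>x. \<Sum>i\<in>A. c i * f i x)"
  using assms
proof (induction A)
  case empty
  have "subexp_deriv \<beta> n (\<lambda>_. 0)"
    by (induction n) (auto intro!: exI[of _ "\<lambda>_. 0"])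
  then show ?case by simp
next
  case (insert i A)
  then show ?case
    using subexp_deriv_lincomb[of \<beta> n "f i" "\<lambda>x. \<Sum>i\<in>A. c i * f i x" "c i" 1] by simp
qed

text \<open>Averaging \<open>h (Suc n)\<close> once gives the unit difference of its primitive
  \<open>h n\<close>, which is again covered by the induction hypothesis.\<close>

lemma subexp_deriv_iterated_derivative:
  assumes "subexp_deriv \<beta> 0 (h 0)"
    and "\<And>i x. \<lbrakk>i < n; x \<ge> 0\<rbrakk> \<Longrightarrow> (h i has_vector_derivative h (Suc i) x) (at x within {0..})"
  shows "subexp_deriv \<beta> n (h n)"
  using assms(2)
proof (induction n)
  case 0
  then show ?case using assms(1) by simp
next
  case (Suc n)
  then have "subexp_deriv \<beta> n (h n)"
    by simp
  then have "subexp_deriv \<beta> n (\<lambda>x. 1 * h n (x + 1) + (-1) * h n x)"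
    by (intro subexp_deriv_lincomb subexp_deriv_shift)
  then show ?case
    using Suc.prems[of n] by auto
qed

text \<open>Each averaging multiplies \<open>C\<close> by the nonzero number
  \<open>(exp \<beta> - 1) / \<beta>\<close>, so \<open>C\<close> has to vary in the induction.
  After all averagings a constant tends to 0.\<close>

lemma subexp_deriv_exp_imp_zero:
  assumes "\<beta> > 0"
  shows "\<lbrakk>subexp_deriv \<beta> n h; \<And>x. x \<ge> 0 \<Longrightarrow> h x = C * of_real (exp (\<beta> * x))\<rbrakk> \<Longrightarrow> C = 0"
proof (induction n arbitrary: h C)
  case 0
  have "exp (- \<beta> * x) *\<^sub>R h x = C" if "x \<ge> 0" for x
    by (simp add: 0(2)[OF that] scaleR_conv_of_real exp_minus)
  then have "\<forall>\<^sub>F x in at_top. exp (- \<beta> * x) *\<^sub>R h x = C"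
    unfolding eventually_at_top_linorder by blast
  then have "((\<lambda>x. exp (- \<beta> * x) *\<^sub>R h x) \<longlongrightarrow> C) at_top"
    by (rule tendsto_eventually)
  moreover have "((\<lambda>x. exp (- \<beta> * x) *\<^sub>R h x) \<longlongrightarrow> 0) at_top"
    using 0(1) by simp
  ultimately show ?case
    by (rule tendsto_unique[OF trivial_limit_at_top_linorder])
next
  case (Suc n)
  then obtain H where H: "\<And>x. x \<ge> 0 \<Longrightarrow> (H has_vector_derivative h x) (at x within {0..})"
    "subexp_deriv \<beta> n (\<lambda>x. H (x + 1) - H x)"
    by auto
  \<comment> \<open>An explicit primitive of \<open>h\<close>. It differs from \<open>H\<close> by a
    constant, which cancels in the unit difference.\<close>
  define E where "E = (\<lambda>x. C / of_real \<beta> * of_real (exp (\<beta> * x)))"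
  have "((\<lambda>x. H x - E x) has_vector_derivative 0) (at x within {0..})" if "x \<in> {0..}" for x
  proof -
    have "(E has_vector_derivative h x) (at x within {0..})"
      unfolding E_def using Suc.prems(2)[of x] that assms
      by (auto intro!: derivative_eq_intros simp: field_simps scaleR_conv_of_real)
    then show ?thesis
      using has_vector_derivative_diff[OF H(1)[of x]] that by fastforce
  qed
  then obtain k where k: "\<And>x. x \<in> {0..} \<Longrightarrow> H x - E x = k"
    using has_vector_derivative_zero_constant[of "{0..}" "\<lambda>x. H x - E x"] by (auto simp: convex_real_interval)
  have "H (x + 1) - H x = C / of_real \<beta> * of_real (exp \<beta> - 1) * of_real (exp (\<beta> * x))" if "x \<ge> 0" for x
  proof -
    have "H (x + 1) - H x = E (x + 1) - E x"
      using k[of x] k[of "x + 1"] that by (simp add: algebra_simps)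
    then show ?thesis
      by (simp add: E_def distrib_left exp_add algebra_simps)
  qed
  then have "C / of_real \<beta> * of_real (exp \<beta> - 1) = 0"
    by (rule Suc.IH[OF H(2)])
  then show ?case
    using assms by (auto simp flip: of_real_diff simp del: of_real_diff)
qed

subsection \<open>Solutions in terms of families of derivatives\<close>

text \<open>Explicit candidates \<open>U m n\<close> take the place of iterated
  \<open>vector_derivative\<close> terms, so regularity can be checked by differentiation rules
  alone.\<close>

definition deriv_family ::
    "real set \<Rightarrow> (nat \<times> nat) set \<Rightarrow> (nat \<Rightarrow> nat \<Rightarrow> real \<Rightarrow> real \<Rightarrow> complex) \<Rightarrow> bool" where
  "deriv_family I S U \<longleftrightarrow>
     (\<forall>m n. (m, n) \<in> S \<longrightarrow>
        continuous_on (I \<times> {0..}) (\<lambda>(t, x). U m n t x) \<and>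
        ((Suc m, n) \<in> S \<longrightarrow> (\<forall>t\<in>I. \<forall>x\<ge>0.
           ((\<lambda>\<tau>. U m n \<tau> x) has_vector_derivative U (Suc m) n t x) (at t within I))) \<and>
        ((m, Suc n) \<in> S \<longrightarrow> (\<forall>t\<in>I. \<forall>x\<ge>0.
           ((\<lambda>\<xi>. U m n t \<xi>) has_vector_derivative U m (Suc n) t x) (at x within {0..}))))"

lemma has_continuous_derivs_eq_deriv_family:
  "has_continuous_derivs I S f \<longleftrightarrow> deriv_family I S (\<lambda>m n. partial_deriv I m n f)"
  by (auto simp: has_continuous_derivs_def deriv_family_def)

lemma deriv_familyD:
  assumes "deriv_family I S U" "(m, n) \<in> S"
  shows "continuous_on (I \<times> {0..}) (\<lambda>(t, x). U m n t x)"
    and "\<lbrakk>(Suc m, n) \<in> S; t \<in> I; x \<ge> 0\<rbrakk> \<Longrightarrow>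
      ((\<lambda>\<tau>. U m n \<tau> x) has_vector_derivative U (Suc m) n t x) (at t within I)"
    and "\<lbrakk>(m, Suc n) \<in> S; t \<in> I; x \<ge> 0\<rbrakk> \<Longrightarrow>
      ((\<lambda>\<xi>. U m n t \<xi>) has_vector_derivative U m (Suc n) t x) (at x within {0..})"
  using assms unfolding deriv_family_def by blast+

lemma deriv_family_lincomb:
  assumes "\<And>k. k \<in> K \<Longrightarrow> deriv_family I S (U k)"
  shows "deriv_family I S (\<lambda>m n t x. \<Sum>k\<in>K. c k * U k m n t x)"
  unfolding deriv_family_def case_prod_unfold
  using deriv_familyD[OF assms]
  by (auto simp: case_prod_unfold intro!: continuous_intros derivative_intros)

lemma deriv_family_cong:
  assumes "deriv_family I S U"
    and "\<And>m n t x. \<lbrakk>(m, n) \<in> S; t \<in> I; x \<ge> 0\<rbrakk> \<Longrightarrow> V m n t x = U m n t x"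
  shows "deriv_family I S V"
  unfolding deriv_family_def
proof (intro allI impI conjI ballI)
  fix m n assume mn: "(m, n) \<in> S"
  show "continuous_on (I \<times> {0..}) (\<lambda>(t, x). V m n t x)"
    by (rule continuous_on_eq[OF deriv_familyD(1)[OF assms(1) mn]]) (auto simp: assms(2) mn)
  fix t x assume tx: "t \<in> I" "(x :: real) \<ge> 0"
  show "((\<lambda>\<tau>. V m n \<tau> x) has_vector_derivative V (Suc m) n t x) (at t within I)"
    if "(Suc m, n) \<in> S"
    using has_vector_derivative_transform[OF tx(1) _ deriv_familyD(2)[OF assms(1) mn that tx],
        of "\<lambda>\<tau>. V m n \<tau> x"]
    by (simp add: assms(2) mn that tx)
  show "((\<lambda>\<xi>. V m n t \<xi>) has_vector_derivative V m (Suc n) t x) (at x within {0..})"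
    if "(m, Suc n) \<in> S"
    using has_vector_derivative_transform[OF _ _ deriv_familyD(3)[OF assms(1) mn that tx],
        of "\<lambda>\<xi>. V m n t \<xi>"]
    by (simp add: assms(2) mn that tx)
qed

lemma required_orders_down_closed:
  "\<lbrakk>(m, n) \<in> required_orders a; m' \<le> m; n' \<le> n\<rbrakk> \<Longrightarrow> (m', n') \<in> required_orders a"
  by (auto simp: required_orders_def intro: order_trans)

lemma support_orders_subset_required_orders: "support_orders a \<subseteq> required_orders a"
  by (auto simp: required_orders_def)

lemma vector_derivative_within_eq:
  assumes "at x within T \<noteq> bot" "x \<in> T"
    and "(U has_vector_derivative D) (at x within T)" "\<And>y. y \<in> T \<Longrightarrow> f y = U y"
  shows "vector_derivative f (at x within T) = D"
  using assms by (intro vector_derivative_within has_vector_derivative_transform[OF _ _ assms(3)]) auto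

lemma at_within_half_line_neq_bot: "x \<ge> 0 \<Longrightarrow> at x within {0 :: real..} \<noteq> bot"
  by (rule at_within_interval_neq_bot) (auto simp: is_interval_ci)

text \<open>Induction on \<open>n\<close> with no time derivative, then on \<open>m\<close>, follows
  the order in which \<open>partial_deriv\<close> differentiates. All intermediate orders are
  required ones, and one-sided derivatives are unique at every point.\<close>

lemma partial_deriv_eq_deriv_family:
  assumes I: "is_interval I" "interior I \<noteq> {}"
    and U: "deriv_family I (required_orders a) U"
    and f: "\<And>t x. \<lbrakk>t \<in> I; x \<ge> 0\<rbrakk> \<Longrightarrow> f t x = U 0 0 t x"
    and mn: "(m, n) \<in> required_orders a" and tx: "t \<in> I" "x \<ge> 0"
  shows "partial_deriv I m n f t x = U m n t x"
proof -
  have space: "(deriv_x ^^ n) f t x = U 0 n t x"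
    if "(0, n) \<in> required_orders a" "t \<in> I" "x \<ge> 0" for n t x
    using that
  proof (induction n arbitrary: t x)
    case 0
    then show ?case by (simp add: f)
  next
    case (Suc n)
    then have n: "(0, n) \<in> required_orders a"
      by (auto intro: required_orders_down_closed)
    show ?case
      using vector_derivative_within_eq[OF at_within_half_line_neq_bot _
          deriv_familyD(3)[OF U n Suc.prems], of "\<lambda>\<xi>. (deriv_x ^^ n) f t \<xi>"] Suc.IH[OF n] Suc.prems
      by (simp add: deriv_x_def[of "(deriv_x ^^ n) f"])
  qed
  show ?thesis
    using mn tx
  proof (induction m arbitrary: t x)
    case 0
    then show ?case by (simp add: partial_deriv_def space)
  next
    case (Suc m)
    then have m: "(m, n) \<in> required_orders a"
      by (auto intro: required_orders_down_closed)
    show ?case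
      using vector_derivative_within_eq[OF at_within_interval_neq_bot[OF I] _
          deriv_familyD(2)[OF U m Suc.prems], of "\<lambda>\<tau>. partial_deriv I m n f \<tau> x"] Suc.IH[OF m] Suc.prems
      by (simp add: partial_deriv_def deriv_t_def)
  qed
qed

lemma solves_pdeI:
  assumes I: "is_interval I" "interior I \<noteq> {}"
    and U: "deriv_family I (required_orders a) U"
    and f: "\<And>t x. \<lbrakk>t \<in> I; x \<ge> 0\<rbrakk> \<Longrightarrow> f t x = U 0 0 t x"
    and pde: "\<And>t x. \<lbrakk>t \<in> I; x \<ge> 0\<rbrakk> \<Longrightarrow> (\<Sum>(m, n)\<in>support_orders a. a m n * U m n t x) = 0"
  shows "solves_pde a I f"
proof -
  have eq: "partial_deriv I m n f t x = U m n t x"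
    if "(m, n) \<in> required_orders a" "t \<in> I" "x \<ge> 0" for m n t x
    by (rule partial_deriv_eq_deriv_family[OF I U f that])
  have "(\<Sum>(m, n)\<in>support_orders a. a m n * partial_deriv I m n f t x) =
      (\<Sum>(m, n)\<in>support_orders a. a m n * U m n t x)" if "t \<in> I" "x \<ge> 0" for t x
    using that eq support_orders_subset_required_orders[of a] by (intro sum.cong) auto
  then show ?thesis
    unfolding solves_pde_def has_continuous_derivs_eq_deriv_family
    using deriv_family_cong[OF U eq] pde by auto
qed

lemma solves_pde_lincomb:
  assumes I: "is_interval I" "interior I \<noteq> {}"
    and f: "\<And>k. k \<in> K \<Longrightarrow> solves_pde a I (f k)"
    and g: "\<And>t x. \<lbrakk>t \<in> I; x \<ge> 0\<rbrakk> \<Longrightarrow> g t x = (\<Sum>k\<in>K. c k * f k t x)"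
  shows "solves_pde a I g"
proof (rule solves_pdeI[OF I])
  let ?U = "\<lambda>m n t x. \<Sum>k\<in>K. c k * partial_deriv I m n (f k) t x"
  show "deriv_family I (required_orders a) ?U"
    using f by (intro deriv_family_lincomb)
      (simp add: solves_pde_def has_continuous_derivs_eq_deriv_family)
  show "g t x = ?U 0 0 t x" if "t \<in> I" "x \<ge> 0" for t x
    using g[OF that] by (simp add: partial_deriv_def)
  fix t x assume tx: "t \<in> I" "(x :: real) \<ge> 0"
  have "(\<Sum>(m, n)\<in>support_orders a. a m n * ?U m n t x) =
      (\<Sum>k\<in>K. c k * (\<Sum>(m, n)\<in>support_orders a. a m n * partial_deriv I m n (f k) t x))"
    unfolding sum_distrib_left case_prod_unfold by (subst sum.swap) (simp add: mult.left_commute)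
  also have "\<dots> = 0"
    using f tx by (simp add: solves_pde_def)
  finally show "(\<Sum>(m, n)\<in>support_orders a. a m n * ?U m n t x) = 0" .
qed

subsection \<open>The exponentially weighted tail integral\<close>

definition exp_tail :: "real \<Rightarrow> (real \<Rightarrow> real \<Rightarrow> complex) \<Rightarrow> real \<Rightarrow> real \<Rightarrow> complex" where
  "exp_tail \<beta> f t x = (LINT s:{x..}|lborel. of_real (exp (- \<beta> * (s - x))) * f t s)"

definition exp_weighted :: "real \<Rightarrow> (real \<Rightarrow> real \<Rightarrow> complex) \<Rightarrow> real \<Rightarrow> real \<Rightarrow> complex" where
  "exp_weighted \<beta> f t s = of_real (exp (- \<beta> * s)) * f t s"

text \<open>The condition in \<open>T_inverse_converges\<close> for a single function, with \<beta>
  in place of \<open>\<alpha> / real N\<close>.\<close>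

definition exp_tail_converges :: "real \<Rightarrow> real set \<Rightarrow> (real \<Rightarrow> real \<Rightarrow> complex) \<Rightarrow> bool" where
  "exp_tail_converges \<beta> I f \<longleftrightarrow>
     (\<forall>t\<in>I. set_integrable lborel {0..} (exp_weighted \<beta> f t)) \<and>
     (\<forall>K \<epsilon>. compact K \<and> K \<subseteq> I \<and> \<epsilon> > 0 \<longrightarrow>
        (\<exists>R\<ge>0. \<forall>t\<in>K. (LINT s:{R..}|lborel. norm (exp_weighted \<beta> f t s)) < \<epsilon>))"

lemma exp_tail_converges_integrable:
  "\<lbrakk>exp_tail_converges \<beta> I f; t \<in> I\<rbrakk> \<Longrightarrow> set_integrable lborel {0..} (exp_weighted \<beta> f t)"
  by (simp add: exp_tail_converges_def)

lemma exp_tail_converges_tail: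
  "\<lbrakk>exp_tail_converges \<beta> I f; compact K; K \<subseteq> I; \<epsilon> > 0\<rbrakk> \<Longrightarrow>
    \<exists>R\<ge>0. \<forall>t\<in>K. (LINT s:{R..}|lborel. norm (exp_weighted \<beta> f t s)) < \<epsilon>"
  by (simp add: exp_tail_converges_def)

text \<open>Splitting the weight as \<open>exp (\<beta> * x)\<close> times
  \<open>exp (- \<beta> * s)\<close> removes \<open>x\<close> from the integrand. Continuity, both
  derivatives and the growth bound are read off from this form.\<close>

lemma exp_tail_eq:
  assumes "exp_tail_converges \<beta> I f" "t \<in> I" "x \<ge> 0"
  shows "exp_tail \<beta> f t x = of_real (exp (\<beta> * x)) *
    (integral {0..} (exp_weighted \<beta> f t) - integral {0..x} (exp_weighted \<beta> f t))"
proof -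
  have "exp_tail \<beta> f t x =
      (LINT s:{x..}|lborel. of_real (exp (\<beta> * x)) * exp_weighted \<beta> f t s)"
    unfolding exp_tail_def exp_weighted_def
    by (intro set_lebesgue_integral_cong)
      (auto simp: algebra_simps simp flip: of_real_mult exp_add)
  then show ?thesis
    using tail_integral_eq[OF exp_tail_converges_integrable[OF assms(1,2)] assms(3)] by simp
qed

lemma continuous_on_exp_weighted:
  assumes "continuous_on (I \<times> {0..}) (\<lambda>(t, x). f t x)"
  shows "continuous_on (I \<times> {0..}) (\<lambda>(t, x). exp_weighted \<beta> f t x)"
  using assms unfolding exp_weighted_def case_prod_unfold by (intro continuous_intros)

lemma continuous_on_exp_tail:
  assumes I: "is_interval I"
    and cont: "continuous_on (I \<times> {0..}) (\<lambda>(t, x). f t x)"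
    and conv: "exp_tail_converges \<beta> I f"
  shows "continuous_on (I \<times> {0..}) (\<lambda>(t, x). exp_tail \<beta> f t x)"
proof -
  note w = continuous_on_exp_weighted[OF cont, of \<beta>]
  have "continuous_on I (\<lambda>t. integral {0..} (exp_weighted \<beta> f t))"
    by (rule continuous_on_integral_half_line[OF I w exp_tail_converges_integrable[OF conv]
          exp_tail_converges_tail[OF conv]])
  then have "continuous_on (I \<times> {0 :: real..}) (\<lambda>p. integral {0..} (exp_weighted \<beta> f (fst p)))"
    by (rule continuous_on_compose2) (auto intro: continuous_on_fst continuous_on_id)
  then have "continuous_on (I \<times> {0..}) (\<lambda>p. of_real (exp (\<beta> * snd p)) *
      (integral {0..} (exp_weighted \<beta> f (fst p)) - integral {0..snd p} (exp_weighted \<beta> f (fst p))))"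
    using continuous_on_integral_from_zero[OF w] unfolding case_prod_unfold
    by (intro continuous_intros)
  then show ?thesis
    by (rule continuous_on_eq) (auto simp: exp_tail_eq[OF conv])
qed

text \<open>By the product rule: the outer exponential cancels the weight at the end point
  \<open>x\<close>, so continuity of \<open>f\<close> suffices.\<close>

lemma exp_tail_has_vector_derivative_x:
  assumes cont: "continuous_on (I \<times> {0..}) (\<lambda>(t, x). f t x)"
    and conv: "exp_tail_converges \<beta> I f" and tx: "t \<in> I" "x \<ge> 0"
  shows "(exp_tail \<beta> f t has_vector_derivative of_real \<beta> * exp_tail \<beta> f t x - f t x)
    (at x within {0..})"
proof -
  let ?w = "exp_weighted \<beta> f t"
  have "continuous_on {0..} ?w"
    by (rule continuous_on_section[OF continuous_on_exp_weighted[OF cont] tx(1)])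
  then have "((\<lambda>x. integral {0..x} ?w) has_vector_derivative ?w x) (at x within {0..})"
    using tx(2) by (rule has_vector_derivative_indefinite_integral_half_line)
  then have "((\<lambda>x. of_real (exp (\<beta> * x)) * (integral {0..} ?w - integral {0..x} ?w))
      has_vector_derivative of_real (exp (\<beta> * x)) * (0 - ?w x) +
        of_real (\<beta> * exp (\<beta> * x)) * (integral {0..} ?w - integral {0..x} ?w)) (at x within {0..})"
    by (intro has_vector_derivative_mult has_vector_derivative_diff has_vector_derivative_const)
      (auto intro!: derivative_eq_intros)
  moreover have "of_real (exp (\<beta> * x)) * (0 - ?w x) +
        of_real (\<beta> * exp (\<beta> * x)) * (integral {0..} ?w - integral {0..x} ?w) =
      of_real \<beta> * exp_tail \<beta> f t x - f t x"
    by (simp add: exp_tail_eq[OF conv tx] exp_weighted_def exp_minus algebra_simps)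
  ultimately have "((\<lambda>x. of_real (exp (\<beta> * x)) * (integral {0..} ?w - integral {0..x} ?w))
      has_vector_derivative of_real \<beta> * exp_tail \<beta> f t x - f t x) (at x within {0..})"
    by simp
  then show ?thesis
    by (rule has_vector_derivative_transform[rotated 2])
      (use tx in \<open>auto simp: exp_tail_eq[OF conv]\<close>)
qed

text \<open>The half-line integral is differentiated through the uniform tails of \<open>f\<close>
  and \<open>f'\<close>, the integral up to \<open>x\<close> by the Leibniz rule.\<close>

lemma exp_tail_has_vector_derivative_t:
  assumes I: "is_interval I"
    and cont: "continuous_on (I \<times> {0..}) (\<lambda>(t, x). f t x)"
    and cont': "continuous_on (I \<times> {0..}) (\<lambda>(t, x). f' t x)"
    and deriv: "\<And>t x. \<lbrakk>t \<in> I; x \<ge> 0\<rbrakk> \<Longrightarrow>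
      ((\<lambda>\<tau>. f \<tau> x) has_vector_derivative f' t x) (at t within I)"
    and conv: "exp_tail_converges \<beta> I f" and conv': "exp_tail_converges \<beta> I f'"
    and tx: "t \<in> I" "x \<ge> 0"
  shows "((\<lambda>\<tau>. exp_tail \<beta> f \<tau> x) has_vector_derivative exp_tail \<beta> f' t x) (at t within I)"
proof -
  note w = continuous_on_exp_weighted[OF cont, of \<beta>] continuous_on_exp_weighted[OF cont', of \<beta>]
  have dw: "((\<lambda>\<tau>. exp_weighted \<beta> f \<tau> s) has_vector_derivative exp_weighted \<beta> f' t s) (at t within I)"
    if "t \<in> I" "s \<ge> 0" for t s
    unfolding exp_weighted_def using deriv[OF that] by (rule has_vector_derivative_mult_right)
  have "((\<lambda>\<tau>. of_real (exp (\<beta> * x)) *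
        (integral {0..} (exp_weighted \<beta> f \<tau>) - integral {0..x} (exp_weighted \<beta> f \<tau>)))
      has_vector_derivative of_real (exp (\<beta> * x)) *
        (integral {0..} (exp_weighted \<beta> f' t) - integral {0..x} (exp_weighted \<beta> f' t))) (at t within I)"
    by (intro has_vector_derivative_mult_right has_vector_derivative_diff
        has_vector_derivative_integral_half_line[OF I tx(1) w dw
          exp_tail_converges_integrable[OF conv] exp_tail_converges_integrable[OF conv']
          exp_tail_converges_tail[OF conv] exp_tail_converges_tail[OF conv']]
        has_vector_derivative_integral_from_zero[OF I tx(1) w dw])
  then show ?thesis
    using has_vector_derivative_transform[of t I "\<lambda>\<tau>. exp_tail \<beta> f \<tau> x"] tx
    by (simp add: exp_tail_eq[OF conv] exp_tail_eq[OF conv'])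
qed

text \<open>Multiplied by \<open>exp (- \<beta> * x)\<close>, the function is the tail of a
  convergent integral.\<close>

lemma exp_tail_subexp:
  assumes I: "is_interval I"
    and cont: "continuous_on (I \<times> {0..}) (\<lambda>(t, x). f t x)"
    and conv: "exp_tail_converges \<beta> I f" and t: "t \<in> I"
  shows "subexp_deriv \<beta> 0 (exp_tail \<beta> f t)"
proof -
  let ?w = "exp_weighted \<beta> f t"
  have "uniform_limit {t} (\<lambda>R t. integral {0..R} (exp_weighted \<beta> f t))
      (\<lambda>t. integral {0..} (exp_weighted \<beta> f t)) at_top"
    using t exp_tail_converges_integrable[OF conv] exp_tail_converges_tail[OF conv, of "{t}"]
    by (intro uniform_limit_integral_tail) auto
  then have "((\<lambda>x. integral {0..x} ?w) \<longlongrightarrow> integral {0..} ?w) at_top"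
    by (rule tendsto_uniform_limitI) simp
  then have "((\<lambda>x. integral {0..} ?w - integral {0..x} ?w) \<longlongrightarrow> integral {0..} ?w - integral {0..} ?w) at_top"
    by (intro tendsto_intros)
  moreover have "\<forall>\<^sub>F x in at_top. exp (- \<beta> * x) *\<^sub>R exp_tail \<beta> f t x = integral {0..} ?w - integral {0..x} ?w"
    using eventually_ge_at_top[of 0]
    by eventually_elim (simp add: exp_tail_eq[OF conv t] scaleR_conv_of_real exp_minus)
  ultimately show ?thesis
    using continuous_on_section[OF continuous_on_exp_tail[OF I cont conv] t]
    by (simp add: tendsto_cong)
qed

text \<open>
  Iterating \<open>\<partial>\<^sub>x J = \<beta> J - f\<close> for \<open>J = exp_tail \<beta> f\<close> expresses all derivatives of \<open>J\<close> by
  those of \<open>f\<close>, without integrability of the \<open>x\<close>-derivatives of \<open>f\<close>.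
\<close>

primrec exp_tail_family ::
    "real \<Rightarrow> (nat \<Rightarrow> nat \<Rightarrow> real \<Rightarrow> real \<Rightarrow> complex) \<Rightarrow> nat \<Rightarrow> nat \<Rightarrow> real \<Rightarrow> real \<Rightarrow> complex" where
  "exp_tail_family \<beta> P m 0 = exp_tail \<beta> (P m 0)"
| "exp_tail_family \<beta> P m (Suc n) =
     (\<lambda>t x. of_real \<beta> * exp_tail_family \<beta> P m n t x - P m n t x)"

text \<open>Order \<open>(m, Suc n)\<close> need not be a required one: the tail integral is one
  \<open>x\<close>-derivative smoother than \<open>f\<close>. This extra derivative allows the
  differential expression itself to be differentiated.\<close>

lemma exp_tail_family_has_vector_derivative_x:
  assumes P: "deriv_family I (required_orders a) P"
    and conv: "\<And>m. (m, 0) \<in> required_orders a \<Longrightarrow> exp_tail_converges \<beta> I (P m 0)"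
    and mn: "(m, n) \<in> required_orders a" and tx: "t \<in> I" "x \<ge> 0"
  shows "(exp_tail_family \<beta> P m n t has_vector_derivative exp_tail_family \<beta> P m (Suc n) t x)
    (at x within {0..})"
  using mn
proof (induction n)
  case 0
  then show ?case
    using exp_tail_has_vector_derivative_x[OF deriv_familyD(1)[OF P 0] conv[OF 0] tx] by simp
next
  case (Suc n)
  then have n: "(m, n) \<in> required_orders a"
    by (auto intro: required_orders_down_closed)
  then have "((\<lambda>\<xi>. of_real \<beta> * exp_tail_family \<beta> P m n t \<xi> - P m n t \<xi>) has_vector_derivative
      of_real \<beta> * exp_tail_family \<beta> P m (Suc n) t x - P m (Suc n) t x) (at x within {0..})"
    by (intro has_vector_derivative_diff has_vector_derivative_mult_right Suc.IH
        deriv_familyD(3)[OF P n Suc.prems tx])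
  then show ?case by simp
qed

lemma deriv_family_exp_tail_family:
  assumes I: "is_interval I"
    and P: "deriv_family I (required_orders a) P"
    and conv: "\<And>m. (m, 0) \<in> required_orders a \<Longrightarrow> exp_tail_converges \<beta> I (P m 0)"
  shows "deriv_family I (required_orders a) (exp_tail_family \<beta> P)"
  unfolding deriv_family_def
proof (intro allI impI conjI ballI)
  fix m n assume mn: "(m, n) \<in> required_orders a"
  then show "continuous_on (I \<times> {0..}) (\<lambda>(t, x). exp_tail_family \<beta> P m n t x)"
  proof (induction n)
    case 0
    then show ?case
      using continuous_on_exp_tail[OF I deriv_familyD(1)[OF P 0] conv[OF 0]] by simp
  next
    case (Suc n)
    then have n: "(m, n) \<in> required_orders a"
      by (auto intro: required_orders_down_closed)
    show ?case
      using Suc.IH[OF n] deriv_familyD(1)[OF P n] unfolding case_prod_unfold exp_tail_family.simps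
      by (intro continuous_intros)
  qed
  fix t x assume tx: "t \<in> I" "(x :: real) \<ge> 0"
  show "(exp_tail_family \<beta> P m n t has_vector_derivative exp_tail_family \<beta> P m (Suc n) t x)
      (at x within {0..})"
    by (rule exp_tail_family_has_vector_derivative_x[OF P conv mn tx])
  assume "(Suc m, n) \<in> required_orders a"
  \<comment> \<open>Only order \<open>n = 0\<close> involves differentiation under the integral;
    higher orders inherit it from the recursion.\<close>
  then show "((\<lambda>\<tau>. exp_tail_family \<beta> P m n \<tau> x) has_vector_derivative
      exp_tail_family \<beta> P (Suc m) n t x) (at t within I)"
  proof (induction n)
    case 0
    then have m: "(m, 0) \<in> required_orders a"
      by (auto intro: required_orders_down_closed)
    show ?case
      using exp_tail_has_vector_derivative_t[OF I deriv_familyD(1)[OF P m] deriv_familyD(1)[OF P 0]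
          deriv_familyD(2)[OF P m 0] conv[OF m] conv[OF 0] tx] by simp
  next
    case (Suc n)
    then have n: "(m, n) \<in> required_orders a" "(Suc m, n) \<in> required_orders a"
      by (auto intro: required_orders_down_closed)
    show ?case
      unfolding exp_tail_family.simps
      by (intro has_vector_derivative_diff has_vector_derivative_mult_right Suc.IH n(2)
          deriv_familyD(2)[OF P n tx])
  qed
qed

lemma solves_pde_exp_tail:
  assumes I: "is_interval I" "interior I \<noteq> {}" and \<beta>: "\<beta> > 0"
    and fin: "finite (support_orders a)"
    and f: "solves_pde a I f"
    and conv: "\<And>m. (m, 0) \<in> required_orders a \<Longrightarrow> exp_tail_converges \<beta> I (partial_deriv I m 0 f)"
  shows "solves_pde a I (exp_tail \<beta> f)"
proof (rule solves_pdeI[OF I])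
  define P where "P = (\<lambda>m n. partial_deriv I m n f)"
  define J where "J = exp_tail_family \<beta> P"
  have pde: "(\<Sum>(m, n)\<in>support_orders a. a m n * P m n t x) = 0" if "t \<in> I" "x \<ge> 0" for t x
    using f that by (simp add: solves_pde_def P_def)
  have conv: "exp_tail_converges \<beta> I (P m 0)" if "(m, 0) \<in> required_orders a" for m
    using conv[OF that] by (simp add: P_def)
  have P: "deriv_family I (required_orders a) P"
    using f by (simp add: solves_pde_def has_continuous_derivs_eq_deriv_family P_def)
  show "deriv_family I (required_orders a) J"
    unfolding J_def by (rule deriv_family_exp_tail_family[OF I(1) P conv])
  show "exp_tail \<beta> f t x = J 0 0 t x" for t x
    by (simp add: J_def P_def partial_deriv_def)
  have supp: "(m, n) \<in> required_orders a" if "(m, n) \<in> support_orders a" for m n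
    using that support_orders_subset_required_orders by blast
  have dJ: "(J m n t has_vector_derivative J m (Suc n) t x) (at x within {0..})"
    if "(m, n) \<in> required_orders a" "t \<in> I" "x \<ge> 0" for m n t x
    unfolding J_def by (rule exp_tail_family_has_vector_derivative_x[OF P conv that])
  fix t x assume t: "t \<in> I" and x: "(x :: real) \<ge> 0"
  define W where "W = (\<lambda>x. \<Sum>p\<in>support_orders a. a (fst p) (snd p) * J (fst p) (snd p) t x)"
  have W': "(W has_vector_derivative of_real \<beta> * W x) (at x within {0..})" if "x \<ge> 0" for x
  proof -
    have "(W has_vector_derivative
        (\<Sum>p\<in>support_orders a. a (fst p) (snd p) * J (fst p) (Suc (snd p)) t x)) (at x within {0..})"
      unfolding W_def using dJ[OF supp t that]
      by (intro has_vector_derivative_sum has_vector_derivative_mult_right) auto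
    \<comment> \<open>By the recursion of \<open>exp_tail_family\<close>, raising every
      \<open>x\<close>-order by one gives \<open>\<beta>\<close> times \<open>W\<close> minus the
      left side of the equation for \<open>f\<close>, which vanishes.\<close>
    moreover have "(\<Sum>p\<in>support_orders a. a (fst p) (snd p) * J (fst p) (Suc (snd p)) t x) =
        of_real \<beta> * W x - (\<Sum>(m, n)\<in>support_orders a. a m n * P m n t x)"
      by (simp add: J_def W_def case_prod_unfold sum_distrib_left algebra_simps sum_subtractf)
    ultimately show ?thesis
      using pde[OF t that] by simp
  qed
  \<comment> \<open>An integrating factor for the equation just found for \<open>W\<close>.\<close>
  have "((\<lambda>x. of_real (exp (- \<beta> * x)) * W x) has_vector_derivative 0) (at x within {0..})"
    if "x \<in> {0..}" for x
  proof -
    have "((\<lambda>x. of_real (exp (- \<beta> * x)) * W x) has_vector_derivative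
        of_real (exp (- \<beta> * x)) * (of_real \<beta> * W x) + of_real (- \<beta> * exp (- \<beta> * x)) * W x)
        (at x within {0..})"
      using that by (intro has_vector_derivative_mult W') (auto intro!: derivative_eq_intros)
    then show ?thesis by simp
  qed
  then obtain C where "\<And>x. x \<in> {0..} \<Longrightarrow> of_real (exp (- \<beta> * x)) * W x = C"
    using has_vector_derivative_zero_constant[of "{0..}" "\<lambda>x. of_real (exp (- \<beta> * x)) * W x"]
    by (metis convex_real_interval(1))
  then have C: "W x = C * of_real (exp (\<beta> * x))" if "x \<ge> 0" for x
    using that by (force simp: exp_minus field_simps)
  \<comment> \<open>The highest \<open>x\<close>-order in the equation serves as common number of
    averagings; inserting 0 covers the case of no nonzero coefficient.\<close>
  define M where "M = Max (insert 0 (snd ` support_orders a))"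
  have "subexp_deriv \<beta> M (J (fst p) (snd p) t)" if "p \<in> support_orders a" for p
  proof (rule subexp_deriv_mono[OF \<beta>])
    \<comment> \<open>All \<open>x\<close>-orders down to 0 are available, so the chain of
      derivatives starts at the tail integral of a time derivative, whose growth is known.\<close>
    have p: "(fst p, i) \<in> required_orders a" if "i \<le> snd p" for i
      using required_orders_down_closed[OF supp[of "fst p" "snd p"] order_refl that]
        \<open>p \<in> support_orders a\<close> by simp
    show "snd p \<le> M"
      unfolding M_def using fin that by (intro Max_ge) auto
    show "subexp_deriv \<beta> (snd p) (J (fst p) (snd p) t)"
    proof (rule subexp_deriv_iterated_derivative[where h = "\<lambda>i. J (fst p) i t"])
      show "subexp_deriv \<beta> 0 (J (fst p) 0 t)"
        using exp_tail_subexp[OF I(1) deriv_familyD(1)[OF P p] conv[OF p] t]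
        by (simp add: J_def del: subexp_deriv.simps)
    qed (use dJ p t in auto)
  qed
  then have "subexp_deriv \<beta> M W"
    unfolding W_def by (rule subexp_deriv_sum[OF fin])
  then have "C = 0"
    using subexp_deriv_exp_imp_zero[OF \<beta>] C by blast
  then show "(\<Sum>(m, n)\<in>support_orders a. a m n * J m n t x) = 0"
    using C[OF x] by (simp add: W_def case_prod_unfold)
qed

subsection \<open>The vertex conditions\<close>

theorem mainTheorem1:
  fixes N :: nat and \<alpha> :: real and I :: "real set"
    and a :: "nat \<Rightarrow> nat \<Rightarrow> complex"
    and v :: "nat \<Rightarrow> real \<Rightarrow> real \<Rightarrow> complex"
  assumes "N \<ge> 1" and "\<alpha> > 0"
    and "is_interval I" and "interior I \<noteq> {}"
    and "finite (support_orders a)"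
    and "dirichlet_solution N a I v"
    and "T_inverse_converges \<alpha> N a I v"
  shows "exner_seba_solution \<alpha> N a I (T_inverse \<alpha> N v)"
proof -
  define \<beta> where "\<beta> = \<alpha> / real N"
  have \<beta>: "\<beta> > 0"
    using assms(1,2) by (simp add: \<beta>_def)
  define u where "u = T_inverse \<alpha> N v"
  define J where "J = (\<lambda>k. exp_tail \<beta> (v k))"
  define P where "P = (\<lambda>k. partial_deriv I 0 1 (v k))"
  have v: "solves_pde a I (v k)" "\<And>t. t \<in> I \<Longrightarrow> v k t 0 = 0" if "k \<in> {1..N}" for k
    using assms(6) that by (auto simp: dirichlet_solution_def)
  have conv: "exp_tail_converges \<beta> I (partial_deriv I m 0 (v k))"
    if "k \<in> {1..N}" "(m, 0) \<in> required_orders a" for k m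
    using assms(7) that
    unfolding T_inverse_converges_def Let_def exp_tail_converges_def exp_weighted_def \<beta>_def
    by (simp add: mult.commute)
  have orders: "(0, 0) \<in> required_orders a" "(0, Suc 0) \<in> required_orders a"
    by (auto simp: required_orders_def)
  have conv0: "exp_tail_converges \<beta> I (v k)" if "k \<in> {1..N}" for k
    using conv[OF that orders(1)] by (simp add: partial_deriv_def)
  have J: "solves_pde a I (J k)" if "k \<in> {1..N}" for k
    unfolding J_def by (rule solves_pde_exp_tail[OF assms(3,4) \<beta> assms(5) v(1)[OF that] conv[OF that]])
  have family: "deriv_family I (required_orders a) (\<lambda>m n. partial_deriv I m n (v k))" if "k \<in> {1..N}" for k
    using v(1)[OF that] by (simp add: solves_pde_def has_continuous_derivs_eq_deriv_family)
  \<comment> \<open>The derivative exists because order (0, 1) is always among the required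
    ones.\<close>
  have dv: "(v k t has_vector_derivative P k t 0) (at 0 within {0..})"
    if "k \<in> {1..N}" "t \<in> I" for k t
    using deriv_familyD(3)[OF family[OF that(1)] orders that(2), of 0]
    by (simp add: P_def partial_deriv_def)
  \<comment> \<open>The Dirichlet condition removes the term \<open>v k t 0\<close> from the
    derivative.\<close>
  have dJ: "(J k t has_vector_derivative of_real \<beta> * J k t 0) (at 0 within {0..})"
    if "k \<in> {1..N}" "t \<in> I" for k t
    using exp_tail_has_vector_derivative_x[OF _ conv0[OF that(1)] that(2), of 0]
      deriv_familyD(1)[OF family[OF that(1)] orders(1)] v(2)[OF that]
    by (simp add: J_def partial_deriv_def)
  have u_eq: "u j t x = 1 / of_real \<alpha> * (1 / of_nat N * (\<Sum>k=1..N. v k t x) - v j t x)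
      - 1 / (of_nat N)\<^sup>2 * (\<Sum>k=1..N. J k t x)" if "t \<in> I" "x \<ge> 0" for j t x
  proof -
    \<comment> \<open>Integrability of each summand justifies exchanging the integral with the
      finite sum.\<close>
    have int: "set_integrable lborel {x..} (\<lambda>s. of_real (exp (- \<beta> * (s - x))) * v k t s)"
      if "k \<in> {1..N}" for k
    proof -
      have "set_integrable lborel {x..} (\<lambda>s. of_real (exp (\<beta> * x)) * exp_weighted \<beta> (v k) t s)"
        by (rule set_integrable_mult_right,
            rule set_integrable_subset[OF exp_tail_converges_integrable[OF conv0[OF that] \<open>t \<in> I\<close>]])
          (use \<open>x \<ge> 0\<close> in auto)
      then show ?thesis
        by (simp add: exp_weighted_def algebra_simps flip: of_real_mult exp_add)
    qed
    have "(LINT s:{x..}|lborel. of_real (exp (- \<alpha> * (s - x) / real N)) * (\<Sum>k=1..N. v k t s)) =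
        (LINT s:{x..}|lborel. (\<Sum>k=1..N. of_real (exp (- \<beta> * (s - x))) * v k t s))"
      by (simp add: \<beta>_def sum_distrib_left)
    also have "\<dots> = (\<Sum>k=1..N. J k t x)"
      using int unfolding J_def exp_tail_def set_lebesgue_integral_def set_integrable_def scaleR_sum_right
      by (intro Bochner_Integration.integral_sum)
    finally show ?thesis
      by (simp add: u_def T_inverse_def)
  qed
  have "solves_pde a I (u j)" if "j \<in> {1..N}" for j
  proof (rule solves_pde_lincomb[OF assms(3,4)])
    \<comment> \<open>With the Kronecker delta \<open>e\<close>, the single term \<open>v j\<close>
      becomes a sum over all edges. The Boolean tag merges the \<open>v k\<close> and the
      \<open>J k\<close> into one indexed family, to which linearity applies.\<close>
    define e :: "nat \<Rightarrow> complex" where "e k = (if k = j then 1 else 0)" for k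
    let ?f = "\<lambda>(k, b). if b then v k else J k"
    let ?c = "\<lambda>(k, b). if b then (1 / of_nat N - e k) / of_real \<alpha> else - 1 / (of_nat N)\<^sup>2"
    show "solves_pde a I (?f p)" if "p \<in> {1..N} \<times> UNIV" for p
      using that v(1) J by auto
    fix t x assume tx: "t \<in> I" "(x :: real) \<ge> 0"
    have "(\<Sum>p\<in>{1..N} \<times> UNIV. ?c p * ?f p t x) =
        (\<Sum>k=1..N. \<Sum>b\<in>UNIV. ?c (k, b) * ?f (k, b) t x)"
      unfolding sum.cartesian_product by (intro sum.cong) auto
    also have "\<dots> = (\<Sum>k=1..N. (1 / of_nat N - e k) / of_real \<alpha> * v k t x - 1 / (of_nat N)\<^sup>2 * J k t x)"
      by (simp add: UNIV_bool)
    also have "\<dots> = 1 / of_real \<alpha> * (1 / of_nat N * (\<Sum>k=1..N. v k t x)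
        - (\<Sum>k=1..N. e k * v k t x)) - 1 / (of_nat N)\<^sup>2 * (\<Sum>k=1..N. J k t x)"
      by (simp add: sum_subtractf sum.distrib sum_distrib_left algebra_simps diff_divide_distrib sum_divide_distrib)
    also have "(\<Sum>k=1..N. e k * v k t x) = v j t x"
      using that by (simp add: e_def if_distrib[of "\<lambda>z. z * _"] cong: if_cong)
    finally show "u j t x = (\<Sum>p\<in>{1..N} \<times> UNIV. ?c p * ?f p t x)"
      by (simp add: u_eq[OF tx])
  qed
  moreover have "\<exists>c. (\<forall>j\<in>{1..N}. u j t 0 = c) \<and> (\<Sum>j=1..N. deriv_x (u j) t 0) = of_real \<alpha> * c"
    if t: "t \<in> I" for t
  proof (intro exI conjI ballI)
    let ?S = "\<Sum>k=1..N. J k t 0"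
    \<comment> \<open>At the vertex all \<open>v\<close> terms vanish, and what remains does not
      depend on \<open>j\<close>.\<close>
    show "u j t 0 = - 1 / (of_nat N)\<^sup>2 * ?S" if "j \<in> {1..N}" for j
      using that v(2) t by (simp add: u_eq)
    define D where "D = (\<lambda>j. 1 / of_real \<alpha> * (1 / of_nat N * (\<Sum>k=1..N. P k t 0) - P j t 0)
      - 1 / (of_nat N)\<^sup>2 * (\<Sum>k=1..N. of_real \<beta> * J k t 0))"
    have "deriv_x (u j) t 0 = D j" if "j \<in> {1..N}" for j
      unfolding deriv_x_def
    proof (rule vector_derivative_within_eq)
      show "((\<lambda>x. 1 / of_real \<alpha> * (1 / of_nat N * (\<Sum>k=1..N. v k t x) - v j t x)
          - 1 / (of_nat N)\<^sup>2 * (\<Sum>k=1..N. J k t x)) has_vector_derivative D j) (at 0 within {0..})"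
        unfolding D_def using that t
        by (intro has_vector_derivative_diff has_vector_derivative_mult_right has_vector_derivative_sum dv dJ)
    qed (use u_eq t at_within_half_line_neq_bot in auto)
    then have "(\<Sum>j=1..N. deriv_x (u j) t 0) = (\<Sum>j=1..N. D j)"
      by simp
    \<comment> \<open>Summed over the edges, the mean of the \<open>P k t 0\<close> occurs
      \<open>N\<close> times and cancels their sum; the rest gives the vertex condition because
      \<open>N\<close> times \<beta> is \<alpha>.\<close>
    also have "\<dots> = 1 / of_real \<alpha> * (of_nat N * (1 / of_nat N * (\<Sum>k=1..N. P k t 0)) - (\<Sum>j=1..N. P j t 0))
        - of_nat N * (1 / (of_nat N)\<^sup>2 * (of_real \<beta> * ?S))"
      unfolding D_def sum_subtractf sum_distrib_left[symmetric] by simp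
    also have "\<dots> = of_real \<alpha> * (- 1 / (of_nat N)\<^sup>2 * ?S)"
      using assms(1) by (simp add: \<beta>_def)
    finally show "(\<Sum>j=1..N. deriv_x (u j) t 0) = of_real \<alpha> * (- 1 / (of_nat N)\<^sup>2 * ?S)" .
  qed
  ultimately show ?thesis
    by (simp add: exner_seba_solution_def u_def)
qed

end
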